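(* Consider the network utility maximization problem $\max_{x\in\mathcal X} \sum_{i=1}^n f_i(x_i)$ subject to $Ax\le c$, and the Safe Dual Gradient Method (SDGM), both as defined in the context, under the standing assumptions stated there. Let $\gamma_-^t>0$, $t\ge 1$, be the minus step sizes of the SDGM, and for every $t\ge 1$ let the safety margins and plus step sizes be $$\Delta_j^t=\frac{[AA^Te_m]_j}{\mu}\,\gamma_-^t\quad\text{for all } j\in[m],\qquad \gamma_+^t=(m-1)\gamma_-^t .$$ Then for all $t\ge 1$ the primal iterates $x^t$ produced by the SDGM are feasible, i.e. $$Ax^t-c\le 0,\qquad \forall t\ge 1 .$$
   Context: Notation. $[n]=\{1,\dots,n\}$; $[v]_i$ or $v_i$ is the $i$-th entry of a vector $v$; vector inequalities are element-wise; $\mathbb R_+$ is the set of non-negative reals; $e_m\in\mathbb R^m$ is the all-ones vector. Problem. Let $n,m$ be positive integers, $A\in\{0,1\}^{m\times n}$, $c\in\mathbb R_+^m$, and $\mathcal X=\mathcal X_1\times\cdots\times\mathcal X_n$ with $\mathcal X_i=[\underline x_i,\overline x_i]$, where $\underline x_i\ge 0$ and $\overline x_i=\infty$ is allowed. For each $i\in[n]$, $f_i$ is a strictly increasing, concave, differentiable utility function. The problem is $$\max_{x\in\mathcal X} f(x)=\sum_{i=1}^n f_i(x_i)\quad\text{subject to } Ax\le c .$$ The feasible region is $\overline{\mathcal X}=\mathcal X\cap\{x: Ax\le c\}$; it is compact, with $\overline{\mathcal X}\subseteq\prod_{i\in[n]}[\underline x_i,\max_{j\in[m]}c_j]$. Strong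 concavity. A differentiable function $g$ is $\mu$-strongly concave over a domain $D$ if $\mu>0$ and $\langle\nabla g(x_2)-\nabla g(x_1),x_1-x_2\rangle\ge\mu\|x_1-x_2\|^2$ for all $x_1,x_2\in D$ (Euclidean norm). Standing assumptions. (1) For every $i\in[n]$, $f_i$ is $\mu_i$-strongly concave over $\overline{\mathcal X}$ (that is, in the variable $x_i$ as $x$ ranges over $\overline{\mathcal X}$). Put $\mu=\min_{i\in[n]}\mu_i$. (2) (Slater) There is $\tilde x$ in the relative interior of $\mathcal X$ with $A\tilde x<c$. (3) There is a bound $\overline\lambda$ (the same for all constraints) such that for every $j\in[m]$: whenever a dual vector $\lambda^t\in\mathbb R_+^m$ has $\lambda_j^t=\overline\lambda$, the users' response $x^t$ to $\lambda^t$ (defined below) satisfies $[Ax^t-c]_j\le 0$. Safe Dual Gradient Method (SDGM). Inputs: step sizes $\gamma_-^t$, $\gamma_+^t$ and safety margin vectors $\Delta^t\in\mathbb R_+^m$, $t\ge1$. Initialize $\lambda_j^1=\overline\lambda$ for all $j\in[m]$. For $t=1,2,\dots$: - each user $i\in[n]$ receives the price $p_i^t=[A^T\lambda^t]_i$ and responds with $x_i^t=\arg\max_{x_i\in\mathcal X_i}\, f_i(x_i)-p_i^tx_i$ (the maximizers are taken to exist); - for each $j\in[m]$ the dual variable is updated by $$\lambda_j^{t+1}=\max\{0,\lambda_j^t-\gamma_-^t\}\ \text{ if } [Ax^t+\Delta^t-c]_j<0,\qquad \lambda_j^{t+1}=\min\{\overline\lambda,\lambda_j^t+\gamma_+^t\}\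 \text{ if } [Ax^t+\Delta^t-c]_j\ge 0 .$$ *)

theory Defs
  imports "HOL-Analysis.Analysis"
begin

text \<open>The order on \<open>real^'m\<close> is the element-wise one. Its strict part \<open><\<close> is not the element-wise
  strict inequality, so strict vector inequalities are written out by components.\<close>

definition user_set :: "('n \<Rightarrow> real) \<Rightarrow> ('n \<Rightarrow> ereal) \<Rightarrow> 'n \<Rightarrow> real set" where
  "user_set xlo xhi i = {y. xlo i \<le> y \<and> ereal y \<le> xhi i}"

definition primal_domain :: "('n::finite \<Rightarrow> real) \<Rightarrow> ('n \<Rightarrow> ereal) \<Rightarrow> (real^'n) set" where
  "primal_domain xlo xhi = {x. \<forall>i. x $ i \<in> user_set xlo xhi i}"

definition feasible_region ::
  "real^'n^'m \<Rightarrow> real^'m \<Rightarrow> ('n::finite \<Rightarrow> real) \<Rightarrow> ('n \<Rightarrow> ereal) \<Rightarrow> (real^'n) set" where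
  "feasible_region A c xlo xhi = primal_domain xlo xhi \<inter> {x. A *v x \<le> c}"

text \<open>The gradient is taken within \<open>D\<close>, so that it is one-sided at the boundary. It is uniquely
  determined when \<open>D\<close> is a nondegenerate real interval; for a one-point \<open>D\<close> the inequality holds
  trivially.\<close>

definition strongly_concave_on :: "real \<Rightarrow> 'a::euclidean_space set \<Rightarrow> ('a \<Rightarrow> real) \<Rightarrow> bool" where
  "strongly_concave_on \<mu> D g \<longleftrightarrow>
     \<mu> > 0 \<and>
     (\<exists>grad :: 'a \<Rightarrow> 'a.
        (\<forall>x\<in>D. (g has_derivative (\<lambda>h. grad x \<bullet> h)) (at x within D)) \<and>
        (\<forall>x1\<in>D. \<forall>x2\<in>D. (grad x2 - grad x1) \<bullet> (x1 - x2) \<ge> \<mu> * (norm (x1 - x2))\<^sup>2))"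

text \<open>A response is any vector of maximizers; neither existence nor uniqueness of the maximizers is
  built in.\<close>

definition user_response ::
  "('n \<Rightarrow> real \<Rightarrow> real) \<Rightarrow> real^'n^'m \<Rightarrow> ('n::finite \<Rightarrow> real) \<Rightarrow> ('n \<Rightarrow> ereal) \<Rightarrow>
     real^'m \<Rightarrow> real^'n \<Rightarrow> bool" where
  "user_response f A xlo xhi lam x \<longleftrightarrow>
     (\<forall>i. is_arg_max (\<lambda>y. f i y - (transpose A *v lam) $ i * y)
            (\<lambda>y. y \<in> user_set xlo xhi i) (x $ i))"

text \<open>Sequences are indexed from \<open>1\<close>; their values at \<open>0\<close> play no role.\<close>

definition sdgm ::
  "('n \<Rightarrow> real \<Rightarrow> real) \<Rightarrow> real^'n^'m \<Rightarrow> real^'m \<Rightarrow> ('n::finite \<Rightarrow> real) \<Rightarrow> ('n \<Rightarrow> ereal) \<Rightarrow> real \<Rightarrow>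
     (nat \<Rightarrow> real) \<Rightarrow> (nat \<Rightarrow> real) \<Rightarrow> (nat \<Rightarrow> real^'m) \<Rightarrow>
     (nat \<Rightarrow> real^'m) \<Rightarrow> (nat \<Rightarrow> real^'n) \<Rightarrow> bool" where
  "sdgm f A c xlo xhi lam_max \<gamma>_minus \<gamma>_plus \<Delta> lams xs \<longleftrightarrow>
     (\<forall>j. lams 1 $ j = lam_max) \<and>
     (\<forall>t\<ge>1.
        user_response f A xlo xhi (lams t) (xs t) \<and>
        (\<forall>j. lams (t + 1) $ j =
           (if (A *v xs t + \<Delta> t - c) $ j < 0
            then max 0 (lams t $ j - \<gamma>_minus t)
            else min lam_max (lams t $ j + \<gamma>_plus t))))"

end

theory Submission
  imports Defs
begin

text \<open>The induction invariant is stronger than feasibility of \<open>x\<^sup>t\<close>: every response to \<open>\<lambda>\<^sup>t\<close> is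
  feasible. Strong concavity is only available on the feasible region, where it makes the response
  to \<open>\<lambda>\<^sup>t\<close> unique; feasibility of a single response would not exclude another, infeasible one for
  the same prices.
  Let \<open>y\<close> be a response to \<open>\<lambda>\<^sup>t\<^sup>+\<^sup>1\<close>. A dual
  variable that is raised by \<open>(m - 1) \<gamma>\<close> outweighs the decreases of all the
  others, so the users of that constraint face no lower price and do not increase their demand. The
  price of user \<open>i\<close> drops by at most \<open>d\<^sub>i \<gamma>\<close>, where
  \<open>d\<^sub>i\<close> is the number of constraints that contain \<open>i\<close>, so by strong
  concavity the demand grows by at most \<open>d\<^sub>i \<gamma> / \<mu>\<close>; the safety margin
  of a constraint is the sum of these bounds over its users. A constraint whose dual variable is
  capped at its upper bound holds by assumption.\<close>

section \<open>One user: maximizers of utility minus payment under two prices\<close>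

text \<open>First-order conditions give \<open>grad x \<le> p\<close> and
  \<open>q \<le> grad z\<close>; strong concavity then bounds the gradient drop below. The point
  \<open>z\<close> may stop short of the maximizer \<open>y\<close>, because \<open>D\<close> need
  not reach \<open>y\<close>.\<close>

lemma argmax_gap:
  fixes f :: "real \<Rightarrow> real"
  assumes conc: "concave_on U f" and strong: "strongly_concave_on m D f"
    and x: "is_arg_max (\<lambda>u. f u - p * u) (\<lambda>u. u \<in> U) x"
    and y: "is_arg_max (\<lambda>u. f u - q * u) (\<lambda>u. u \<in> U) y"
    and "x < z" "z \<le> y" and D: "{x..z} \<subseteq> D"
  shows "m * (z - x) \<le> p - q"
proof -
  have xU: "x \<in> U" and xmax: "\<And>u. u \<in> U \<Longrightarrow> f u - p * u \<le> f x - p * x"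
    and yU: "y \<in> U" and ymax: "\<And>u. u \<in> U \<Longrightarrow> f u - q * u \<le> f y - q * y"
    using x y by (auto simp: is_arg_max_linorder)
  have "convex U"
    using conc by (simp add: concave_on_iff)
  then have U: "u \<in> U" if "x \<le> u" "u \<le> y" for u
    using that xU yU by (meson mem_is_interval_1_I is_interval_convex_1)
  obtain grad where
    grad: "\<And>u. u \<in> D \<Longrightarrow> (f has_derivative (\<lambda>h. grad u \<bullet> h)) (at u within D)" and
    mono: "\<And>u v. u \<in> D \<Longrightarrow> v \<in> D \<Longrightarrow> m * (norm (u - v))\<^sup>2 \<le> (grad v - grad u) \<bullet> (u - v)"
    using strong unfolding strongly_concave_on_def by blast
  have der: "(f has_real_derivative grad u) (at u within {x..z})" if "u \<in> {x..z}" for u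
  proof -
    have "(f has_derivative (\<lambda>h. grad u \<bullet> h)) (at u within {x..z})"
      using grad D that has_derivative_subset by blast
    then show ?thesis
      by (simp add: has_field_derivative_def)
  qed
  have "grad x \<le> p"
  proof (rule ccontr)
    assume "\<not> grad x \<le> p"
    have "((\<lambda>u. f u - p * u) has_real_derivative grad x - p) (at x within {x..z})"
      using \<open>x < z\<close> by (auto intro!: derivative_eq_intros der)
    then have "\<exists>d>0. \<forall>h>0. x + h \<in> {x..z} \<longrightarrow> h < d \<longrightarrow> f x - p * x < f (x + h) - p * (x + h)"
      by (rule has_real_derivative_pos_inc_right) (use \<open>\<not> grad x \<le> p\<close> in simp)
    then obtain d where "d > 0"
      and d: "\<And>h. h > 0 \<Longrightarrow> x + h \<in> {x..z} \<Longrightarrow> h < d \<Longrightarrow> f x - p * x < f (x + h) - p * (x + h)"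
      by blast
    define h where "h = min (d / 2) (z - x)"
    have h: "h > 0" "h < d" "x + h \<le> z"
      using \<open>d > 0\<close> \<open>x < z\<close> by (auto simp: h_def)
    then show False
      using d[of h] xmax[of "x + h"] U[of "x + h"] \<open>z \<le> y\<close> by fastforce
  qed
  \<comment> \<open>Otherwise some \<open>w\<close> left of \<open>z\<close> has a larger objective
    at price \<open>q\<close>. A concave objective cannot fall between \<open>w\<close> and its
    maximizer \<open>y\<close>, and \<open>z\<close> is the convex combination of the two with
    weight \<open>t\<close>.\<close>
  moreover have "q \<le> grad z"
  proof (rule ccontr)
    assume "\<not> q \<le> grad z"
    have "((\<lambda>u. f u - q * u) has_real_derivative grad z - q) (at z within {x..z})"
      using \<open>x < z\<close> by (auto intro!: derivative_eq_intros der)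
    then have "\<exists>d>0. \<forall>h>0. z - h \<in> {x..z} \<longrightarrow> h < d \<longrightarrow> f z - q * z < f (z - h) - q * (z - h)"
      by (rule has_real_derivative_neg_dec_left) (use \<open>\<not> q \<le> grad z\<close> in simp)
    then obtain d where "d > 0"
      and d: "\<And>h. h > 0 \<Longrightarrow> z - h \<in> {x..z} \<Longrightarrow> h < d \<Longrightarrow> f z - q * z < f (z - h) - q * (z - h)"
      by blast
    define h where "h = min (d / 2) (z - x)"
    have h: "h > 0" "h < d" "x \<le> z - h"
      using \<open>d > 0\<close> \<open>x < z\<close> by (auto simp: h_def)
    define w where "w = z - h"
    have w: "w < z" "w \<in> U"
      using h U[of w] \<open>z \<le> y\<close> by (auto simp: w_def)
    have less: "f z - q * z < f w - q * w"
      using d[of h] h by (auto simp: w_def)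
    define t where "t = (z - w) / (y - w)"
    have t: "0 \<le> t" "t \<le> 1"
      using w \<open>z \<le> y\<close> by (auto simp: t_def)
    have "t * (y - w) = z - w"
      using w \<open>z \<le> y\<close> by (simp add: t_def)
    then have z: "z = (1 - t) * w + t * y"
      by (simp add: algebra_simps)
    have "f z \<ge> (1 - t) * f w + t * f y"
      using concave_onD[OF conc t w(2) yU] by (simp add: z[symmetric])
    moreover have "q * z = (1 - t) * (q * w) + t * (q * y)"
      by (subst z) (simp add: algebra_simps)
    ultimately have "(1 - t) * (f w - q * w) + t * (f y - q * y) \<le> f z - q * z"
      by (simp add: algebra_simps)
    moreover have "t * (f w - q * w) \<le> t * (f y - q * y)"
      using ymax[OF w(2)] t by (simp add: mult_left_mono)
    ultimately show False
      using less by (simp add: algebra_simps)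
  qed
  moreover have "m * (z - x) \<le> grad x - grad z"
  proof -
    have "(m * (z - x)) * (z - x) \<le> (grad x - grad z) * (z - x)"
      using mono[of z x] subsetD[OF D, of x] subsetD[OF D, of z] \<open>x < z\<close>
      by (simp add: power2_eq_square algebra_simps)
    then show ?thesis
      using \<open>x < z\<close> by simp
  qed
  ultimately show ?thesis
    by linarith
qed

text \<open>Adding the two optimality inequalities cancels the values of \<open>f\<close>.\<close>

lemma argmax_antimono:
  fixes f :: "real \<Rightarrow> real"
  assumes x: "is_arg_max (\<lambda>u. f u - p * u) (\<lambda>u. u \<in> U) x"
    and y: "is_arg_max (\<lambda>u. f u - q * u) (\<lambda>u. u \<in> U) y"
    and "p < q"
  shows "y \<le> x"
proof -
  have "f y - p * y \<le> f x - p * x" "f x - q * x \<le> f y - q * y"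
    using x y by (auto simp: is_arg_max_linorder)
  then have "(q - p) * y \<le> (q - p) * x"
    by (simp add: algebra_simps)
  then show ?thesis
    using \<open>p < q\<close> by simp
qed

section \<open>User responses and the feasible region\<close>

locale network =
  fixes A :: "real^'n^'m" and c :: "real^'m"
    and xlo :: "'n::finite \<Rightarrow> real" and xhi :: "'n \<Rightarrow> ereal"
    and f :: "'n \<Rightarrow> real \<Rightarrow> real" and \<mu>s :: "'n \<Rightarrow> real"
  assumes A_01: "\<And>j i. A $ j $ i \<in> {0, 1}"
    and concave: "\<And>i. concave_on (user_set xlo xhi i) (f i)"
    and strongly_concave:
      "\<And>i. strongly_concave_on (\<mu>s i) ((\<lambda>x. x $ i) ` feasible_region A c xlo xhi) (f i)"
    and feasible_nonempty: "feasible_region A c xlo xhi \<noteq> {}"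
begin

lemma A_nonneg: "0 \<le> A $ j $ i"
  using A_01[of j i] by auto

lemma response_argmax:
  assumes "user_response f A xlo xhi lam x"
  shows "is_arg_max (\<lambda>u. f i u - (transpose A *v lam) $ i * u) (\<lambda>u. u \<in> user_set xlo xhi i) (x $ i)"
  using assms by (simp add: user_response_def)

lemma response_in_user_set:
  assumes "user_response f A xlo xhi lam x"
  shows "x $ i \<in> user_set xlo xhi i"
  using response_argmax[OF assms] by (simp add: is_arg_max_def)

text \<open>The witness is the vector of lower bounds with \<open>z\<close> in place of its \<open>i\<close>-th entry; each
  constraint may be verified by comparison with a different vector \<open>w\<close>.\<close>

lemma feasible_coordinate:
  assumes z: "z \<in> user_set xlo xhi i"
    and w: "\<And>j. A $ j $ i = 1 \<Longrightarrow> \<exists>w. (\<forall>k. xlo k \<le> w $ k) \<and> z \<le> w $ i \<and> (A *v w) $ j \<le> c $ j"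
  shows "z \<in> (\<lambda>x. x $ i) ` feasible_region A c xlo xhi"
proof -
  define v :: "real^'n" where "v = (\<chi> k. if k = i then z else xlo k)"
  obtain x where x: "\<And>k. x $ k \<in> user_set xlo xhi k" and Ax: "A *v x \<le> c"
    using feasible_nonempty by (auto simp: feasible_region_def primal_domain_def)
  have lo: "xlo k \<le> x $ k" "ereal (xlo k) \<le> xhi k" for k
    using x[of k] order_trans[of "ereal (xlo k)" "ereal (x $ k)"] by (auto simp: user_set_def)
  have "(A *v v) $ j \<le> c $ j" for j
  proof (cases "A $ j $ i = 1")
    case True
    then obtain w where "\<forall>k. xlo k \<le> w $ k" "z \<le> w $ i" and wj: "(A *v w) $ j \<le> c $ j"
      using assms(2) by blast
    then have "(A *v v) $ j \<le> (A *v w) $ j"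
      by (auto simp: matrix_vector_mult_def v_def intro!: sum_mono mult_left_mono A_nonneg)
    with wj show ?thesis by simp
  next
    \<comment> \<open>Constraint \<open>j\<close> does not involve entry \<open>i\<close>, so any
      feasible \<open>x\<close> serves for comparison.\<close>
    case False
    then have "A $ j $ i = 0"
      using A_01[of j i] by auto
    then have "A $ j $ k * v $ k \<le> A $ j $ k * x $ k" for k
      by (cases "k = i") (auto simp: v_def intro!: mult_left_mono A_nonneg lo)
    then have "(A *v v) $ j \<le> (A *v x) $ j"
      by (auto simp: matrix_vector_mult_def intro!: sum_mono)
    also have "\<dots> \<le> c $ j"
      using Ax by (simp add: less_eq_vec_def)
    finally show ?thesis .
  qed
  moreover have "v $ k \<in> user_set xlo xhi k" for k
    using z lo by (auto simp: v_def user_set_def)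
  ultimately have "v \<in> feasible_region A c xlo xhi"
    by (simp add: feasible_region_def primal_domain_def less_eq_vec_def)
  then show ?thesis
    by (rule rev_image_eqI) (simp add: v_def)
qed

text \<open>Users choose independently, so putting \<open>y\<close> in place of the
  \<open>i\<close>-th entry of \<open>x\<close> gives another response \<open>w\<close>, feasible by
  \<open>feas\<close>. Hence strong concavity is available from \<open>x $ i\<close> to
  \<open>y\<close>, and equal prices leave no room for a gap.\<close>

lemma feasible_response_unique_le:
  assumes feas: "\<And>x. user_response f A xlo xhi lam x \<Longrightarrow> A *v x \<le> c"
    and x: "user_response f A xlo xhi lam x"
    and y: "is_arg_max (\<lambda>u. f i u - (transpose A *v lam) $ i * u) (\<lambda>u. u \<in> user_set xlo xhi i) y"
  shows "y \<le> x $ i"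
proof (rule ccontr)
  assume "\<not> y \<le> x $ i"
  then have less: "x $ i < y" by simp
  define w :: "real^'n" where "w = (\<chi> k. if k = i then y else x $ k)"
  have w: "user_response f A xlo xhi lam w"
    using x y by (auto simp: user_response_def w_def)
  have "u \<in> (\<lambda>x. x $ i) ` feasible_region A c xlo xhi" if u: "u \<in> {x $ i..y}" for u
  proof (rule feasible_coordinate)
    show "u \<in> user_set xlo xhi i"
      using u response_in_user_set[OF x, of i] response_in_user_set[OF w, of i]
        order_trans[of "ereal u" "ereal y"]
      by (auto simp: user_set_def w_def)
    show "\<exists>w. (\<forall>k. xlo k \<le> w $ k) \<and> u \<le> w $ i \<and> (A *v w) $ j \<le> c $ j" for j
      using u response_in_user_set[OF w] feas[OF w]
      by (intro exI[of _ w]) (auto simp: user_set_def less_eq_vec_def w_def)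
  qed
  then have "{x $ i..y} \<subseteq> (\<lambda>x. x $ i) ` feasible_region A c xlo xhi"
    by blast
  then have "\<mu>s i * (y - x $ i) \<le> 0"
    using argmax_gap[OF concave strongly_concave response_argmax[OF x] y less] by fastforce
  moreover have "\<mu>s i > 0"
    using strongly_concave by (simp add: strongly_concave_on_def)
  ultimately show False
    using less by (simp add: mult_le_0_iff)
qed

text \<open>Isolates one iteration. Of the update rule it keeps \<open>lower\<close>, and in
  \<open>cases\<close> three alternatives per constraint: slack beyond the margin, validity at
  \<open>y\<close> (from the cap), or a full raise of the dual variable.\<close>

lemma response_step:
  fixes lam lam' \<delta> :: "real^'m"
  assumes feas: "\<And>x. user_response f A xlo xhi lam x \<Longrightarrow> A *v x \<le> c"
    and x: "user_response f A xlo xhi lam x" and y: "user_response f A xlo xhi lam' y"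
    and \<mu>: "0 < \<mu>" "\<And>i. \<mu> \<le> \<mu>s i" and "0 \<le> g"
    and lower: "\<And>j. lam $ j - g \<le> lam' $ j"
    and \<delta>: "\<And>j. \<delta> $ j = ((A ** transpose A) *v vec 1) $ j / \<mu> * g"
    and cases: "\<And>j. (A *v x + \<delta> - c) $ j < 0 \<or> (A *v y) $ j \<le> c $ j
      \<or> lam $ j + (real CARD('m) - 1) * g \<le> lam' $ j"
  shows "A *v y \<le> c"
proof -
  define p where "p = transpose A *v lam"
  define q where "q = transpose A *v lam'"
  note argmax_x = response_argmax[OF x, folded p_def]
  note argmax_y = response_argmax[OF y, folded q_def]
  define d where "d i = (\<Sum>j\<in>UNIV. A $ j $ i) * (g / \<mu>)" for i
  have d_nonneg: "0 \<le> d i" for i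
    unfolding d_def using \<mu>(1) \<open>0 \<le> g\<close>
    by (intro mult_nonneg_nonneg divide_nonneg_pos sum_nonneg A_nonneg)
  \<comment> \<open>By associativity, \<open>A\<close> acts on \<open>transpose A *v vec 1\<close>,
    the vector of column sums, which \<open>d\<close> scales by \<open>g / \<mu>\<close>.\<close>
  have \<delta>_sum: "\<delta> $ j = (\<Sum>i\<in>UNIV. A $ j $ i * d i)" for j
  proof -
    have "((A ** transpose A) *v vec 1) $ j = (\<Sum>i\<in>UNIV. A $ j $ i * (\<Sum>k\<in>UNIV. A $ k $ i))"
      unfolding matrix_vector_mul_assoc[symmetric]
      by (simp add: matrix_vector_mult_def transpose_def del: transpose_matrix_vector)
    then have "\<delta> $ j = (\<Sum>i\<in>UNIV. A $ j $ i * (\<Sum>k\<in>UNIV. A $ k $ i)) * (g / \<mu>)"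
      by (simp only: \<delta>) simp
    then show ?thesis
      by (simp only: d_def sum_distrib_right[of _ UNIV "g / \<mu>"] mult.assoc)
  qed
  have diff: "q $ i - p $ i = (\<Sum>j\<in>UNIV. A $ j $ i * (lam' $ j - lam $ j))" for i
    by (simp add: p_def q_def matrix_vector_mult_def transpose_def sum_subtractf right_diff_distrib
        del: transpose_matrix_vector)
  have raised: "y $ i \<le> x $ i"
    if "A $ j $ i = 1" "lam $ j + (real CARD('m) - 1) * g \<le> lam' $ j" for i j
  proof -
    \<comment> \<open>The raise of \<open>j\<close> balances a drop of \<open>g\<close> in each of
      the other constraints.\<close>
    have "0 = (real CARD('m) - 1) * g + (\<Sum>k\<in>UNIV - {j}. - g)"
      by (simp add: card_Diff_singleton of_nat_diff algebra_simps)
    also have "\<dots> \<le> A $ j $ i * (lam' $ j - lam $ j) + (\<Sum>k\<in>UNIV - {j}. A $ k $ i * (lam' $ k - lam $ k))"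
    proof (intro add_mono sum_mono)
      show "- g \<le> A $ k $ i * (lam' $ k - lam $ k)" for k
        using A_01[of k i] lower[of k] \<open>0 \<le> g\<close> by auto
    qed (use that in simp)
    also have "\<dots> = q $ i - p $ i"
      by (simp add: diff sum.remove[of UNIV j])
    finally consider "p $ i < q $ i" | "p $ i = q $ i"
      by linarith
    then show ?thesis
    proof cases
      case 1
      then show ?thesis
        using argmax_antimono[OF argmax_x argmax_y] by blast
    next
      case 2
      then show ?thesis
        using feasible_response_unique_le[OF feas x, folded p_def] argmax_y[of i] by simp
    qed
  qed
  \<comment> \<open>Since \<open>y\<close> may be infeasible a priori, \<open>argmax_gap\<close> is
    applied only up to a point \<open>z\<close> slightly beyond \<open>x $ i + d i\<close>, where
    the feasible region still projects onto the whole interval.\<close>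
  have growth: "y $ i \<le> x $ i + d i" for i
  proof (rule ccontr)
    assume "\<not> y $ i \<le> x $ i + d i"
    then have less: "x $ i + d i < y $ i" by simp
    \<comment> \<open>The element \<open>1\<close> inserted below keeps the minimum defined when no
      constraint has such slack.\<close>
    define S where "S = (\<lambda>j. - (A *v x + \<delta> - c) $ j) ` {j. (A *v x + \<delta> - c) $ j < 0}"
    \<comment> \<open>Going beyond \<open>x $ i + d i\<close> by some of the strict slack makes the final inequality strict.\<close>
    define e where "e = Min (insert 1 S)"
    have "finite S"
      by (simp add: S_def)
    then have "0 < e"
      unfolding e_def by (subst Min_gr_iff) (auto simp: S_def)
    have e_le: "e \<le> - (A *v x + \<delta> - c) $ j" if "(A *v x + \<delta> - c) $ j < 0" for j
      unfolding e_def using \<open>finite S\<close> that by (intro Min_le) (auto simp: S_def)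
    define z where "z = min (y $ i) (x $ i + d i + e)"
    have z: "x $ i + d i < z" "z \<le> y $ i" "z \<le> x $ i + d i + e"
      using less \<open>0 < e\<close> by (auto simp: z_def)
    have "u \<in> (\<lambda>x. x $ i) ` feasible_region A c xlo xhi" if u: "u \<in> {x $ i..z}" for u
    proof (rule feasible_coordinate)
      show "u \<in> user_set xlo xhi i"
        using u z response_in_user_set[OF x, of i] response_in_user_set[OF y, of i]
          order_trans[of "ereal u" "ereal (y $ i)"]
        by (auto simp: user_set_def)
      show "\<exists>w. (\<forall>k. xlo k \<le> w $ k) \<and> u \<le> w $ i \<and> (A *v w) $ j \<le> c $ j"
        if Aji: "A $ j $ i = 1" for j
      proof -
        \<comment> \<open>A full raise would force \<open>y $ i \<le> x $ i\<close>. In the other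
          two cases the witness is \<open>y\<close> itself, or \<open>x\<close> with entry
          \<open>i\<close> moved by \<open>d i + e\<close>.\<close>
        have "\<not> lam $ j + (real CARD('m) - 1) * g \<le> lam' $ j"
          using raised[OF Aji] less d_nonneg[of i] by force
        then consider "(A *v y) $ j \<le> c $ j" | "(A *v x + \<delta> - c) $ j < 0"
          using cases[of j] by blast
        then show ?thesis
        proof cases
          case 1
          then show ?thesis
            using u z response_in_user_set[OF y]
            by (intro exI[of _ y]) (auto simp: user_set_def)
        next
          case 2
          \<comment> \<open>The margin of \<open>j\<close> contains \<open>d i\<close> as one
            summand, and \<open>e\<close> fits into the remaining slack.\<close>
          have "d i = A $ j $ i * d i"
            by (simp add: Aji)
          also have "\<dots> \<le> \<delta> $ j"
            unfolding \<delta>_sum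
            by (rule member_le_sum) (auto intro!: mult_nonneg_nonneg A_nonneg d_nonneg)
          finally have "(A *v x) $ j + (d i + e) \<le> c $ j"
            using e_le[OF 2] by simp
          then have "(A *v (x + axis i (d i + e))) $ j \<le> c $ j"
            by (simp add: matrix_vector_right_distrib Aji matrix_vector_mult_def
                axis_def if_distrib[of "(*) _"] sum.distrib distrib_left
                cong: if_cong)
          then show ?thesis
            using u z \<open>0 < e\<close> d_nonneg[of i] response_in_user_set[OF x]
            by (intro exI[of _ "x + axis i (d i + e)"]) (auto simp: user_set_def axis_def add_increasing2)
        qed
      qed
    qed
    \<comment> \<open>The price drop is at most \<open>\<mu> * d i\<close>, too little for an
      interval longer than \<open>d i\<close>.\<close>
    then have "\<mu>s i * (z - x $ i) \<le> p $ i - q $ i"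
      using argmax_gap[OF concave strongly_concave argmax_x argmax_y _ z(2)] z(1) d_nonneg[of i]
      by (simp add: subset_eq)
    also have "p $ i - q $ i = (\<Sum>j\<in>UNIV. A $ j $ i * (lam $ j - lam' $ j))"
      using diff[of i] by (simp add: right_diff_distrib sum_subtractf)
    also have "\<dots> \<le> (\<Sum>j\<in>UNIV. A $ j $ i * g)"
      using lower by (intro sum_mono mult_left_mono A_nonneg) (simp add: algebra_simps)
    also have "\<dots> = \<mu> * d i"
      using \<mu> by (simp add: d_def sum_distrib_right)
    also have "\<dots> < \<mu> * (z - x $ i)"
      using \<mu> z by simp
    also have "\<dots> \<le> \<mu>s i * (z - x $ i)"
      using \<mu> z d_nonneg[of i] by (intro mult_right_mono) auto
    finally show False by simp
  qed
  have "(A *v y) $ j \<le> c $ j" for j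
  proof -
    consider "(A *v y) $ j \<le> c $ j" | "(A *v x + \<delta> - c) $ j < 0"
      | "lam $ j + (real CARD('m) - 1) * g \<le> lam' $ j"
      using cases[of j] by blast
    then show ?thesis
    proof cases
      case 2
      have "(A *v y) $ j \<le> (\<Sum>i\<in>UNIV. A $ j $ i * (x $ i + d i))"
        using growth by (auto simp: matrix_vector_mult_def intro!: sum_mono mult_left_mono A_nonneg)
      also have "\<dots> = (A *v x) $ j + \<delta> $ j"
        by (simp add: \<delta>_sum matrix_vector_mult_def sum.distrib distrib_left)
      finally show ?thesis
        using 2 by simp
    next
      case 3
      have "A $ j $ i * y $ i \<le> A $ j $ i * x $ i" for i
        using A_01[of j i] raised[OF _ 3, of i] by auto
      then have "(A *v y) $ j \<le> (A *v x) $ j"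
        by (auto simp: matrix_vector_mult_def intro!: sum_mono)
      also have "\<dots> \<le> c $ j"
        using feas[OF x] by (simp add: less_eq_vec_def)
      finally show ?thesis .
    qed
  qed
  then show ?thesis
    by (simp add: less_eq_vec_def)
qed

end

section \<open>Induction over the iterations\<close>

theorem proposition1:
  fixes A :: "real^'n^'m" and c :: "real^'m"
    and xlo :: "'n::finite \<Rightarrow> real" and xhi :: "'n \<Rightarrow> ereal"
    and f :: "'n \<Rightarrow> real \<Rightarrow> real" and \<mu>s :: "'n \<Rightarrow> real" and \<mu> :: real
    and lam_max :: real
    and \<gamma>_minus \<gamma>_plus :: "nat \<Rightarrow> real" and \<Delta> :: "nat \<Rightarrow> real^'m"
    and lams :: "nat \<Rightarrow> real^'m" and xs :: "nat \<Rightarrow> real^'n"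
  assumes A_01: "\<And>j i. A $ j $ i \<in> {0, 1}"
    and c_nonneg: "c \<ge> 0"
    and xlo_nonneg: "\<And>i. xlo i \<ge> 0"
    and f_increasing: "\<And>i. strict_mono_on (user_set xlo xhi i) (f i)"
    and f_concave: "\<And>i. concave_on (user_set xlo xhi i) (f i)"
    and f_differentiable: "\<And>i. f i differentiable_on user_set xlo xhi i"
    and feasible_compact: "compact (feasible_region A c xlo xhi)"
    and feasible_bounds:
      "feasible_region A c xlo xhi \<subseteq> {x. \<forall>i. xlo i \<le> x $ i \<and> x $ i \<le> Max (range (\<lambda>j. c $ j))}"
    and f_strongly_concave:
      "\<And>i. strongly_concave_on (\<mu>s i) ((\<lambda>x. x $ i) ` feasible_region A c xlo xhi) (f i)"
    and \<mu>_def: "\<mu> = Min (range \<mu>s)"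
    and slater:
      "\<exists>x \<in> rel_interior (primal_domain xlo xhi). \<forall>j. (A *v x) $ j < c $ j"
    and lam_max_nonneg: "lam_max \<ge> 0"
    and lam_max_bound:
      "\<And>j lam x. lam \<ge> 0 \<Longrightarrow> lam $ j = lam_max \<Longrightarrow> user_response f A xlo xhi lam x
         \<Longrightarrow> (A *v x - c) $ j \<le> 0"
    and \<gamma>_minus_pos: "\<And>t. t \<ge> 1 \<Longrightarrow> \<gamma>_minus t > 0"
    and \<Delta>_def:
      "\<And>t j. t \<ge> 1 \<Longrightarrow> \<Delta> t $ j = ((A ** transpose A) *v vec 1) $ j / \<mu> * \<gamma>_minus t"
    and \<gamma>_plus_def: "\<And>t. t \<ge> 1 \<Longrightarrow> \<gamma>_plus t = (real CARD('m) - 1) * \<gamma>_minus t"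
    and run: "sdgm f A c xlo xhi lam_max \<gamma>_minus \<gamma>_plus \<Delta> lams xs"
  shows "\<forall>t\<ge>1. A *v xs t - c \<le> 0"
proof -
  have \<mu>s_pos: "\<mu>s i > 0" for i
    using f_strongly_concave by (simp add: strongly_concave_on_def)
  have \<mu>: "0 < \<mu>" "\<And>i. \<mu> \<le> \<mu>s i"
    using \<mu>s_pos by (auto simp: \<mu>_def)
  obtain s where "s \<in> primal_domain xlo xhi" "\<And>j. (A *v s) $ j < c $ j"
    using slater rel_interior_subset by blast
  then have "s \<in> feasible_region A c xlo xhi"
    by (auto simp: feasible_region_def less_eq_vec_def less_imp_le)
  then interpret network A c xlo xhi f \<mu>s
    using A_01 f_concave f_strongly_concave by unfold_locales auto
  have resp: "user_response f A xlo xhi (lams t) (xs t)" if "t \<ge> 1" for t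
    using run that by (simp add: sdgm_def)
  have update: "lams (Suc t) $ j = (if (A *v xs t + \<Delta> t - c) $ j < 0
      then max 0 (lams t $ j - \<gamma>_minus t) else min lam_max (lams t $ j + \<gamma>_plus t))"
    if "t \<ge> 1" for t j
    using run that by (simp add: sdgm_def)
  have plus_nonneg: "0 \<le> \<gamma>_plus t" if "t \<ge> 1" for t
    using that \<gamma>_minus_pos[of t] \<gamma>_plus_def[of t] by (simp add: Suc_le_eq)
  \<comment> \<open>Nonnegativity is required by \<open>lam_max_bound\<close>; the upper bound
    ensures that capping at \<open>lam_max\<close> never lowers a dual variable.\<close>
  have inv: "(\<forall>j. 0 \<le> lams t $ j \<and> lams t $ j \<le> lam_max) \<and>
      (\<forall>x. user_response f A xlo xhi (lams t) x \<longrightarrow> A *v x \<le> c)" if "t \<ge> 1" for t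
    using that
  proof (induction t rule: dec_induct)
    case base
    have "lams 1 $ j = lam_max" for j
      using run by (simp add: sdgm_def)
    then show ?case
      using lam_max_nonneg lam_max_bound[of "lams 1"] by (auto simp: less_eq_vec_def)
  next
    case (step t)
    then have t: "t \<ge> 1" by simp
    note pos = \<gamma>_minus_pos[OF t] and plus = plus_nonneg[OF t]
    have bounds: "0 \<le> lams t $ j" "lams t $ j \<le> lam_max" for j
      using step.IH by auto
    have bounds': "0 \<le> lams (Suc t) $ j" "lams (Suc t) $ j \<le> lam_max"
      and lower: "lams t $ j - \<gamma>_minus t \<le> lams (Suc t) $ j" for j
      using bounds[of j] pos plus lam_max_nonneg by (auto simp: update[OF t])
    have "A *v y \<le> c" if y: "user_response f A xlo xhi (lams (Suc t)) y" for y
    proof (rule response_step[OF _ resp[OF t] y \<mu> _ lower \<Delta>_def[OF t]])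
      show "A *v x \<le> c" if "user_response f A xlo xhi (lams t) x" for x
        using step.IH that by blast
      show "0 \<le> \<gamma>_minus t"
        using pos by simp
      \<comment> \<open>In the plus branch the minimum is either \<open>lam_max\<close>, covered
        here, or the full raise by \<open>\<gamma>_plus t\<close>.\<close>
      have "(A *v y) $ j \<le> c $ j" if "lams (Suc t) $ j = lam_max" for j
        using lam_max_bound[OF _ that y] bounds' by (simp add: less_eq_vec_def)
      then show "(A *v xs t + \<Delta> t - c) $ j < 0 \<or> (A *v y) $ j \<le> c $ j
          \<or> lams t $ j + (real CARD('m) - 1) * \<gamma>_minus t \<le> lams (Suc t) $ j" for j
        unfolding \<gamma>_plus_def[OF t, symmetric] using update[OF t, of j] by (auto simp: min_def)
    qed
    then show ?case
      using bounds' by blast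
  qed
  show ?thesis
    using inv resp by (auto simp: less_eq_vec_def)
qed

end
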